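(* Let $G_1$ and $G_2$ be two finite simple graphs with disjoint vertex sets, on $n_1$ and $n_2$ vertices respectively, and for $i=1,2$ let $\Delta_i$ and $\delta_i$ denote the maximum and minimum vertex degree of $G_i$. Then: (i) $\overline{SO}(G_1\cup G_2)\leq \overline{SO}(G_1)+\overline{SO}(G_2)+n_1n_2\sqrt{\Delta_1^2+\Delta_2^2}$; (ii) $\overline{SO}(G_1\cup G_2)\geq \overline{SO}(G_1)+\overline{SO}(G_2)+n_1n_2\sqrt{\delta_1^2+\delta_2^2}$. Moreover, equality holds (in both) if $G_1$ and $G_2$ are regular.
   Context: All graphs are finite and simple, with nonempty vertex set. The union $G_1\cup G_2$ of graphs with disjoint vertex sets is the graph with vertex set $V(G_1)\cup V(G_2)$ and edge set $E(G_1)\cup E(G_2)$. $d_G(u)$ denotes the degree of $u$ in $G$, and $\overline{G}$ is the complement of $G$. The Sombor coindex of $G$ is $$\overline{SO}(G)=\sum_{uv\in E(\overline{G})}\sqrt{d_G(u)^2+d_G(v)^2},$$ the sum being over unordered pairs of distinct non-adjacent vertices of $G$, with degrees taken in $G$. *)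

theory Defs
  imports Complex_Main
begin

record 'a ugraph =
  verts :: "'a set"
  edges :: "'a set set"

definition unordered_pairs :: "'a set \<Rightarrow> 'a set set" where
  "unordered_pairs V = {e. e \<subseteq> V \<and> card e = 2}"

definition simple_graph :: "'a ugraph \<Rightarrow> bool" where
  "simple_graph G \<longleftrightarrow>
     finite (verts G) \<and> verts G \<noteq> {} \<and> edges G \<subseteq> unordered_pairs (verts G)"

definition graph_union :: "'a ugraph \<Rightarrow> 'a ugraph \<Rightarrow> 'a ugraph" where
  "graph_union G H = \<lparr>verts = verts G \<union> verts H, edges = edges G \<union> edges H\<rparr>"

definition complement :: "'a ugraph \<Rightarrow> 'a ugraph" where
  "complement G = \<lparr>verts = verts G, edges = unordered_pairs (verts G) - edges G\<rparr>"

definition degree :: "'a ugraph \<Rightarrow> 'a \<Rightarrow> nat" where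
  "degree G u = card {v \<in> verts G. {u, v} \<in> edges G}"

definition max_degree :: "'a ugraph \<Rightarrow> nat" where
  "max_degree G = Max (degree G ` verts G)"

definition min_degree :: "'a ugraph \<Rightarrow> nat" where
  "min_degree G = Min (degree G ` verts G)"

definition regular :: "'a ugraph \<Rightarrow> bool" where
  "regular G \<longleftrightarrow> (\<exists>r. \<forall>u \<in> verts G. degree G u = r)"

(* Every edge e of the complement is a two-element set {u, v}, so the inner sum
   over e is the sum of the squared degrees (in G) of the two distinct end
   vertices, without choosing an order on them. *)
definition sombor_coindex :: "'a ugraph \<Rightarrow> real" where
  "sombor_coindex G = (\<Sum>e \<in> edges (complement G). sqrt (\<Sum>u \<in> e. (real (degree G u))\<^sup>2))"

(* The inner sum written out for the end vertices of an edge. *)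
lemma sombor_summand:
  "u \<noteq> v \<Longrightarrow> sqrt (\<Sum>w \<in> {u, v}. (real (degree G w))\<^sup>2)
     = sqrt ((real (degree G u))\<^sup>2 + (real (degree G v))\<^sup>2)"
  by simp

end

theory Submission
  imports Defs
begin

text \<open>
  A non-adjacent pair of the disjoint union \<open>G \<union> H\<close> either lies inside one of the two graphs,
  where it is a non-adjacent pair of that graph, or it consists of a vertex of \<open>G\<close> and a vertex
  of \<open>H\<close>; every pair of the latter kind occurs, as no edge joins the two graphs
  (\<open>edges_complement_graph_union\<close>). Degrees do not change under disjoint union
  (\<open>degree_graph_union_left\<close>). Hence the coindex of the union is the sum of both coindices plus
  the sum of \<open>sqrt (d\<^sub>G(u)\<^sup>2 + d\<^sub>H(v)\<^sup>2)\<close> over all pairs \<open>(u, v)\<close>, exactly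
  (\<open>sombor_coindex_graph_union\<close>). This mixed sum has \<open>n\<^sub>1 n\<^sub>2\<close> terms, each between its values at
  the minimum and at the maximum degrees, which gives both bounds. For regular graphs these two
  values coincide, so the bounds meet and both are attained.
\<close>

lemma graph_union_commute: "graph_union G H = graph_union H G"
  by (simp add: graph_union_def Un_commute)

lemma edge_subset_verts:
  assumes "simple_graph G" and "e \<in> edges G"
  shows "e \<subseteq> verts G"
  using assms by (auto simp: simple_graph_def unordered_pairs_def)

lemma finite_edges_complement:
  assumes "simple_graph G"
  shows "finite (edges (complement G))"
proof (rule finite_subset)
  show "edges (complement G) \<subseteq> Pow (verts G)"
    by (auto simp: complement_def unordered_pairs_def)
  show "finite (Pow (verts G))"
    using assms by (simp add: simple_graph_def)
qed

text \<open>
  The union brings \<open>u\<close> no new neighbour: an edge of \<open>H\<close> would have to contain \<open>u\<close>, which is not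
  a vertex of \<open>H\<close>.
\<close>

lemma degree_graph_union_left:
  assumes "simple_graph G" and "simple_graph H"
    and "verts G \<inter> verts H = {}" and "u \<in> verts G"
  shows "degree (graph_union G H) u = degree G u"
proof -
  have "{v \<in> verts G \<union> verts H. {u, v} \<in> edges G \<union> edges H} = {v \<in> verts G. {u, v} \<in> edges G}"
    using edge_subset_verts[OF assms(1)] edge_subset_verts[OF assms(2)] assms(3,4) by blast
  then show ?thesis
    by (simp add: degree_def graph_union_def)
qed

lemma degree_graph_union_right:
  assumes "simple_graph G" and "simple_graph H"
    and "verts G \<inter> verts H = {}" and "v \<in> verts H"
  shows "degree (graph_union G H) v = degree H v"
  using degree_graph_union_left[OF assms(2,1)] assms(3,4)
  by (simp add: graph_union_commute[of G H] Int_commute)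

abbreviation cross_pairs :: "'a ugraph \<Rightarrow> 'a ugraph \<Rightarrow> 'a set set" where
  "cross_pairs G H \<equiv> (\<lambda>(u, v). {u, v}) ` (verts G \<times> verts H)"

lemma unordered_pairs_Un:
  assumes "A \<inter> B = {}"
  shows "unordered_pairs (A \<union> B)
    = unordered_pairs A \<union> unordered_pairs B \<union> (\<lambda>(u, v). {u, v}) ` (A \<times> B)" (is "?L = ?R")
proof
  show "?L \<subseteq> ?R"
  proof
    fix e assume "e \<in> ?L"
    then obtain x y where e: "e = {x, y}" "x \<noteq> y" and xy: "x \<in> A \<union> B" "y \<in> A \<union> B"
      by (auto simp: unordered_pairs_def card_2_iff)
    have swap: "{x, y} = {y, x}"
      by auto
    from xy consider "x \<in> A" "y \<in> A" | "x \<in> B" "y \<in> B" | "x \<in> A" "y \<in> B" | "y \<in> A" "x \<in> B"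
      by auto
    then show "e \<in> ?R"
    proof cases
      case 4
      then have "(y, x) \<in> A \<times> B" by simp
      then show ?thesis unfolding e swap by force
    qed (use e in \<open>auto simp: unordered_pairs_def\<close>)
  qed
  show "?R \<subseteq> ?L"
    using assms by (fastforce simp: unordered_pairs_def card_insert_if)
qed

text \<open>
  An edge is nonempty and stays within the vertices of its own graph, so the edges of \<open>H\<close> remove
  no pair inside \<open>G\<close> and conversely, and no mixed pair is removed at all.
\<close>

lemma edges_complement_graph_union:
  assumes "simple_graph G" and "simple_graph H" and disj: "verts G \<inter> verts H = {}"
  shows "edges (complement (graph_union G H))
    = edges (complement G) \<union> edges (complement H) \<union> cross_pairs G H"
proof -
  have "e \<notin> edges H" if "e \<in> unordered_pairs (verts G)" for e
  proof
    assume "e \<in> edges H"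
    then have "e \<subseteq> verts H"
      by (rule edge_subset_verts[OF assms(2)])
    with that disj have "e = {}"
      by (auto simp: unordered_pairs_def)
    with that show False
      by (simp add: unordered_pairs_def)
  qed
  moreover have "e \<notin> edges G" if "e \<in> unordered_pairs (verts H)" for e
  proof
    assume "e \<in> edges G"
    then have "e \<subseteq> verts G"
      by (rule edge_subset_verts[OF assms(1)])
    with that disj have "e = {}"
      by (auto simp: unordered_pairs_def)
    with that show False
      by (simp add: unordered_pairs_def)
  qed
  moreover have "e \<notin> edges G \<union> edges H" if cross: "e \<in> cross_pairs G H" for e
  proof -
    obtain u v where e: "e = {u, v}" and "u \<in> verts G" "v \<in> verts H"
      using cross by auto
    then have "\<not> e \<subseteq> verts G" "\<not> e \<subseteq> verts H"
      using disj by auto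
    then show ?thesis
      using edge_subset_verts[OF assms(1)] edge_subset_verts[OF assms(2)] by auto
  qed
  ultimately show ?thesis
    unfolding complement_def graph_union_def
    by (simp add: unordered_pairs_Un[OF disj]) blast
qed

lemma sum_cross_pairs:
  fixes f :: "'a set \<Rightarrow> real"
  assumes "verts G \<inter> verts H = {}"
  shows "(\<Sum>e \<in> cross_pairs G H. f e) = (\<Sum>(u, v) \<in> verts G \<times> verts H. f {u, v})"
proof -
  \<comment> \<open>Disjointness tells the two ends of a mixed pair apart.\<close>
  have "inj_on (\<lambda>(u, v). {u, v}) (verts G \<times> verts H)"
    using assms by (auto simp: inj_on_def doubleton_eq_iff)
  then show ?thesis
    by (simp add: sum.reindex case_prod_unfold)
qed

text \<open>
  Both bounds come from this identity; nothing is lost before the degrees in the mixed sum are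
  replaced by their extreme values.
\<close>

lemma sombor_coindex_graph_union:
  assumes G: "simple_graph G" and H: "simple_graph H" and disj: "verts G \<inter> verts H = {}"
  shows "sombor_coindex (graph_union G H) = sombor_coindex G + sombor_coindex H
    + (\<Sum>(u, v) \<in> verts G \<times> verts H. sqrt ((real (degree G u))\<^sup>2 + (real (degree H v))\<^sup>2))"
proof -
  let ?f = "\<lambda>e. sqrt (\<Sum>u \<in> e. (real (degree (graph_union G H) u))\<^sup>2)"
  note degL = degree_graph_union_left[OF assms]
  note degR = degree_graph_union_right[OF assms]
  have fin: "finite (edges (complement G))" "finite (edges (complement H))"
    "finite (cross_pairs G H)"
    using G H by (simp_all add: finite_edges_complement simple_graph_def)
  have verts_G: "e \<subseteq> verts G" "e \<noteq> {}" if "e \<in> edges (complement G)" for e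
    using that by (auto simp: complement_def unordered_pairs_def)
  have verts_H: "e \<subseteq> verts H" "e \<noteq> {}" if "e \<in> edges (complement H)" for e
    using that by (auto simp: complement_def unordered_pairs_def)
  have inside: "edges (complement G) \<inter> edges (complement H) = {}"
  proof (intro equals0I, elim IntE)
    fix e assume "e \<in> edges (complement G)" "e \<in> edges (complement H)"
    from verts_G[OF this(1)] verts_H(1)[OF this(2)] show False
      using disj by auto
  qed
  have mixed: "(edges (complement G) \<union> edges (complement H)) \<inter> cross_pairs G H = {}"
    using verts_G(1) verts_H(1) disj by fastforce
  have "sombor_coindex (graph_union G H)
      = sum ?f (edges (complement G)) + sum ?f (edges (complement H)) + sum ?f (cross_pairs G H)"
    unfolding sombor_coindex_def edges_complement_graph_union[OF assms]
    using fin inside mixed by (simp add: sum.union_disjoint)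
  moreover have "sum ?f (edges (complement G)) = sombor_coindex G"
    unfolding sombor_coindex_def
    by (intro sum.cong refl arg_cong[of _ _ sqrt])
      (use verts_G(1) in \<open>simp add: degL subset_iff\<close>)
  moreover have "sum ?f (edges (complement H)) = sombor_coindex H"
    unfolding sombor_coindex_def
    by (intro sum.cong refl arg_cong[of _ _ sqrt])
      (use verts_H(1) in \<open>simp add: degR subset_iff\<close>)
  moreover have "sum ?f (cross_pairs G H)
      = (\<Sum>(u, v) \<in> verts G \<times> verts H. sqrt ((real (degree G u))\<^sup>2 + (real (degree H v))\<^sup>2))"
    unfolding sum_cross_pairs[OF disj]
  proof (intro sum.cong refl, clarify)
    fix u v assume uv: "u \<in> verts G" "v \<in> verts H"
    then have "u \<noteq> v"
      using disj by auto
    with uv show "?f {u, v} = sqrt ((real (degree G u))\<^sup>2 + (real (degree H v))\<^sup>2)"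
      by (simp add: degL degR)
  qed
  ultimately show ?thesis
    by simp
qed

lemma degree_le_max_degree: "simple_graph G \<Longrightarrow> u \<in> verts G \<Longrightarrow> degree G u \<le> max_degree G"
  by (simp add: simple_graph_def max_degree_def)

lemma min_degree_le_degree: "simple_graph G \<Longrightarrow> u \<in> verts G \<Longrightarrow> min_degree G \<le> degree G u"
  by (simp add: simple_graph_def min_degree_def)

lemma regular_min_degree_eq_max_degree:
  assumes "simple_graph G" and "regular G"
  shows "min_degree G = max_degree G"
proof -
  obtain r where "\<And>u. u \<in> verts G \<Longrightarrow> degree G u = r"
    using assms(2) by (auto simp: regular_def)
  then have "degree G ` verts G = {r}"
    using assms(1) by (auto simp: simple_graph_def)
  then show ?thesis
    by (simp add: min_degree_def max_degree_def)
qed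

theorem theorem5p1:
  fixes G1 G2 :: "'a ugraph" and n1 n2 :: nat
  assumes "simple_graph G1" and "simple_graph G2"
    and "verts G1 \<inter> verts G2 = {}"
    and "card (verts G1) = n1" and "card (verts G2) = n2"
  shows
    "sombor_coindex (graph_union G1 G2)
       \<le> sombor_coindex G1 + sombor_coindex G2
         + real n1 * real n2 * sqrt ((real (max_degree G1))\<^sup>2 + (real (max_degree G2))\<^sup>2)
     \<and> sombor_coindex (graph_union G1 G2)
       \<ge> sombor_coindex G1 + sombor_coindex G2
         + real n1 * real n2 * sqrt ((real (min_degree G1))\<^sup>2 + (real (min_degree G2))\<^sup>2)
     \<and> (regular G1 \<and> regular G2 \<longrightarrow>
         sombor_coindex (graph_union G1 G2)
           = sombor_coindex G1 + sombor_coindex G2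
             + real n1 * real n2 * sqrt ((real (max_degree G1))\<^sup>2 + (real (max_degree G2))\<^sup>2)
       \<and> sombor_coindex (graph_union G1 G2)
           = sombor_coindex G1 + sombor_coindex G2
             + real n1 * real n2 * sqrt ((real (min_degree G1))\<^sup>2 + (real (min_degree G2))\<^sup>2))"
proof -
  let ?s = "\<lambda>a b :: nat. sqrt ((real a)\<^sup>2 + (real b)\<^sup>2)"
  let ?V = "verts G1 \<times> verts G2"
  let ?S = "\<Sum>(u, v) \<in> ?V. ?s (degree G1 u) (degree G2 v)"
  have card: "real (card ?V) = real n1 * real n2"
    using assms(4,5) by (simp add: card_cartesian_product)
  have s_mono: "?s a b \<le> ?s c d" if "a \<le> c" "b \<le> d" for a b c d
    using that by (intro real_sqrt_le_mono add_mono power_mono) auto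
  have id: "sombor_coindex (graph_union G1 G2) = sombor_coindex G1 + sombor_coindex G2 + ?S"
    by (rule sombor_coindex_graph_union[OF assms(1-3)])
  have upper: "?S \<le> real n1 * real n2 * ?s (max_degree G1) (max_degree G2)"
    unfolding card[symmetric]
    by (rule sum_bounded_above) (auto intro!: s_mono degree_le_max_degree assms(1,2))
  have lower: "real n1 * real n2 * ?s (min_degree G1) (min_degree G2) \<le> ?S"
    unfolding card[symmetric]
    by (rule sum_bounded_below) (auto intro!: s_mono min_degree_le_degree assms(1,2))
  have meet: "min_degree G1 = max_degree G1 \<and> min_degree G2 = max_degree G2"
    if "regular G1 \<and> regular G2"
    using that assms(1,2) by (simp add: regular_min_degree_eq_max_degree)
  show ?thesis
  proof (intro conjI impI)
    show "sombor_coindex (graph_union G1 G2) \<le> sombor_coindex G1 + sombor_coindex G2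
        + real n1 * real n2 * ?s (max_degree G1) (max_degree G2)"
      using id upper by simp
    show "sombor_coindex (graph_union G1 G2) \<ge> sombor_coindex G1 + sombor_coindex G2
        + real n1 * real n2 * ?s (min_degree G1) (min_degree G2)"
      using id lower by simp
  next
    assume "regular G1 \<and> regular G2"
    note eq = meet[OF this]
    show "sombor_coindex (graph_union G1 G2) = sombor_coindex G1 + sombor_coindex G2
        + real n1 * real n2 * ?s (max_degree G1) (max_degree G2)"
      using id upper lower eq by simp
    show "sombor_coindex (graph_union G1 G2) = sombor_coindex G1 + sombor_coindex G2
        + real n1 * real n2 * ?s (min_degree G1) (min_degree G2)"
      using id upper lower eq by simp
  qed
qed

end
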